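(* Let $\mathcal D,\mathcal I_j,\mathcal K_{ij},\mathcal Q_{ijk}$ (smooth functions of $(\varepsilon,\boldsymbol x,t)$, the tensors being symmetric with $\delta^{jk}\mathcal Q_{ijk}=\mathcal I_i$, $\delta^{ij}\mathcal K_{ij}=\mathcal D$) and a smooth time-independent velocity $\boldsymbol v(\boldsymbol x)$ satisfy the two-moment model $$\partial_t(\mathcal D+v^i\mathcal I_i)+\partial_i(\mathcal I^i+v^i\mathcal D)-\frac1{\varepsilon^2}\partial_\varepsilon\big(\varepsilon^3\mathcal K^i{}_k\,\partial_iv^k\big)=\chi(\mathcal D_0-\mathcal D),$$ $$\partial_t(\mathcal I_j+v^i\mathcal K_{ij})+\partial_i(\mathcal K^i{}_j+v^i\mathcal I_j)-\frac1{\varepsilon^2}\partial_\varepsilon\big(\varepsilon^3\mathcal Q^i{}_{kj}\,\partial_iv^k\big)+\mathcal I^i\partial_iv_j-\mathcal Q^i{}_{kj}\,\partial_iv^k=-\kappa\,\mathcal I_j .$$ Then the model is, up to $\mathcal O(v)$, consistent with phase-space conservation laws for the energy density $\mathcal E=\varepsilon(\mathcal N+v^i\mathcal G_i)$ and the momentum density $\mathcal P_j=\varepsilon(\mathcal G_j+v_j\mathcal N)$, where $\mathcal N=\mathcal D+v^i\mathcal I_i$ and $\mathcal G_j=\mathcal I_j+v^i\mathcal K_{ij}$. That is, dropping $\mathcal O(v^2)$ terms, $$\partial_t\mathcal E+\partial_i\mathcal P^i-\frac1{\varepsilon^2}\partial_\varepsilon\big(\varepsilon^4\mathcal K^i{}_k\,\partial_iv^k\big)=\varepsilon\chi(\mathcal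 D_0-\mathcal D)-\varepsilon\kappa\,v^j\mathcal I_j,$$ $$\partial_t\mathcal P_j+\partial_i\mathcal S^i{}_j-\frac1{\varepsilon^2}\partial_\varepsilon\big(\varepsilon^4\mathcal Q^i{}_{kj}\,\partial_iv^k\big)=-\varepsilon\kappa\,\mathcal I_j+\varepsilon v_j\chi(\mathcal D_0-\mathcal D),$$ with $\mathcal S^{ij}=\varepsilon(\mathcal K^{ij}+\mathcal I^iv^j+v^i\mathcal I^j)$; these are phase-space conservation laws when $\chi=\kappa=0$.
   Context: Units with speed of light $1$. $\varepsilon>0$ is the particle energy, $\boldsymbol x\in\mathbb R^3$ position; indices are raised and lowered with the Kronecker delta and repeated indices are summed over $1,2,3$. $\mathcal D,\mathcal I_i$ are the zeroth and first angular moments (comoving-frame spectral number density and number flux), $\mathcal K_{ij},\mathcal Q_{ijk}$ the second and third ones (given by a closure), $\mathcal D_0$ a given equilibrium moment, $\chi\ge0$ and $\kappa\ge\chi$ opacities. "$\mathcal O(v^2)$ terms" are finite sums of products containing at least two factors taken from the velocity components $v^i$ and their spatial derivatives $\partial_jv^i$, the other factors being $\varepsilon$, the opacities, the moments, and derivatives of moments. "Phase-space conservation law" means an equation $\partial_tu+\partial_iF^i+\varepsilon^{-2}\partial_\varepsilon(\varepsilon^2F^\varepsilon)=0$. *)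

theory Defs
  imports "HOL-Analysis.Analysis"
begin

primrec times_differentiable_on ::
  "nat \<Rightarrow> 'a::real_normed_vector set \<Rightarrow> ('a \<Rightarrow> 'b::real_normed_vector) \<Rightarrow> bool" where
  "times_differentiable_on 0 S f \<longleftrightarrow> continuous_on S f"
| "times_differentiable_on (Suc n) S f \<longleftrightarrow>
     (\<forall>x\<in>S. f differentiable (at x)) \<and>
     (\<forall>w. times_differentiable_on n S (\<lambda>x. frechet_derivative f (at x) w))"

text \<open>Meaningful for open \<open>S\<close> only, since the derivatives are two-sided.\<close>

definition smooth_on ::
  "'a::real_normed_vector set \<Rightarrow> ('a \<Rightarrow> 'b::real_normed_vector) \<Rightarrow> bool" where
  "smooth_on S f \<longleftrightarrow> (\<forall>n. times_differentiable_on n S f)"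

text \<open>A point of phase space is \<open>(\<epsilon>, x, t)\<close>: energy, position, time.\<close>

type_synonym phase = "real \<times> (real^3) \<times> real"

abbreviation energy :: "phase \<Rightarrow> real" where "energy p \<equiv> fst p"
abbreviation position :: "phase \<Rightarrow> real^3" where "position p \<equiv> fst (snd p)"

datatype coordinate = Energy | Position 3 | Time

fun partial_deriv :: "coordinate \<Rightarrow> (phase \<Rightarrow> real) \<Rightarrow> phase \<Rightarrow> real" where
  "partial_deriv Energy f (e, x, t) = deriv (\<lambda>s. f (s, x, t)) e"
| "partial_deriv (Position i) f (e, x, t) = deriv (\<lambda>s. f (e, x + s *\<^sub>R axis i 1, t)) 0"
| "partial_deriv Time f (e, x, t) = deriv (\<lambda>s. f (e, x, s)) t"

abbreviation dE :: "(phase \<Rightarrow> real) \<Rightarrow> phase \<Rightarrow> real" ("\<partial>\<^sub>\<epsilon>") where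
  "\<partial>\<^sub>\<epsilon> \<equiv> partial_deriv Energy"
abbreviation dX :: "3 \<Rightarrow> (phase \<Rightarrow> real) \<Rightarrow> phase \<Rightarrow> real" ("\<partial>\<^sub>x") where
  "\<partial>\<^sub>x i \<equiv> partial_deriv (Position i)"
abbreviation dT :: "(phase \<Rightarrow> real) \<Rightarrow> phase \<Rightarrow> real" ("\<partial>\<^sub>t") where
  "\<partial>\<^sub>t \<equiv> partial_deriv Time"

text \<open>
  The data of the two-moment model. The equations are imposed at the times in \<open>times\<close>, an
  arbitrary open set. \<open>\<D>\<^sub>0\<close> is the equilibrium moment; \<open>chi\<close> and \<open>kappa\<close> are the opacities.
  Indices are raised and lowered with the Kronecker delta, so upper and lower ones are identified.
\<close>

record moment_data =
  times :: "real set"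
  \<D> :: "phase \<Rightarrow> real"
  \<I> :: "phase \<Rightarrow> real^3"
  \<K> :: "phase \<Rightarrow> real^3^3"
  \<Q> :: "phase \<Rightarrow> real^3^3^3"
  \<D>\<^sub>0 :: "phase \<Rightarrow> real"
  chi :: "phase \<Rightarrow> real"
  kappa :: "phase \<Rightarrow> real"
  velocity :: "real^3 \<Rightarrow> real^3"

definition phase_space :: "moment_data \<Rightarrow> phase set" where
  "phase_space M = {0<..} \<times> UNIV \<times> times M"

definition vel :: "moment_data \<Rightarrow> 3 \<Rightarrow> phase \<Rightarrow> real" where
  "vel M i p = velocity M (position p) $ i"

text \<open>\<open>grad_vel M i k\<close> is \<open>\<partial>\<^sub>i v\<^sup>k\<close>: the first index is that of the derivative.\<close>

definition grad_vel :: "moment_data \<Rightarrow> 3 \<Rightarrow> 3 \<Rightarrow> phase \<Rightarrow> real" where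
  "grad_vel M i k = \<partial>\<^sub>x i (vel M k)"

definition admissible :: "moment_data \<Rightarrow> bool" where
  "admissible M \<longleftrightarrow>
     open (times M) \<and>
     smooth_on (phase_space M) (\<D> M) \<and>
     smooth_on (phase_space M) (\<I> M) \<and>
     smooth_on (phase_space M) (\<K> M) \<and>
     smooth_on (phase_space M) (\<Q> M) \<and>
     smooth_on UNIV (velocity M) \<and>
     (\<forall>p\<in>phase_space M.
        (\<forall>i j. \<K> M p $ i $ j = \<K> M p $ j $ i) \<and>
        (\<forall>i j k. \<Q> M p $ i $ j $ k = \<Q> M p $ j $ i $ k) \<and>
        (\<forall>i j k. \<Q> M p $ i $ j $ k = \<Q> M p $ i $ k $ j) \<and>
        (\<Sum>i\<in>UNIV. \<K> M p $ i $ i) = \<D> M p \<and>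
        (\<forall>i. (\<Sum>j\<in>UNIV. \<Q> M p $ i $ j $ j) = \<I> M p $ i) \<and>
        0 \<le> chi M p \<and> chi M p \<le> kappa M p)"

definition number_density :: "moment_data \<Rightarrow> phase \<Rightarrow> real" where
  "number_density M p = \<D> M p + (\<Sum>i\<in>UNIV. vel M i p * \<I> M p $ i)"

definition number_flux :: "moment_data \<Rightarrow> 3 \<Rightarrow> phase \<Rightarrow> real" where
  "number_flux M j p = \<I> M p $ j + (\<Sum>i\<in>UNIV. vel M i p * \<K> M p $ i $ j)"

definition K_grad :: "moment_data \<Rightarrow> phase \<Rightarrow> real" where
  "K_grad M p = (\<Sum>i\<in>UNIV. \<Sum>k\<in>UNIV. \<K> M p $ i $ k * grad_vel M i k p)"

definition Q_grad :: "moment_data \<Rightarrow> 3 \<Rightarrow> phase \<Rightarrow> real" where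
  "Q_grad M j p = (\<Sum>i\<in>UNIV. \<Sum>k\<in>UNIV. \<Q> M p $ i $ k $ j * grad_vel M i k p)"

definition two_moment_model :: "moment_data \<Rightarrow> bool" where
  "two_moment_model M \<longleftrightarrow>
     admissible M \<and>
     (\<forall>p\<in>phase_space M.
        \<partial>\<^sub>t (number_density M) p
        + (\<Sum>i\<in>UNIV. \<partial>\<^sub>x i (\<lambda>q. \<I> M q $ i + vel M i q * \<D> M q) p)
        - 1 / (energy p)^2 * \<partial>\<^sub>\<epsilon> (\<lambda>q. (energy q)^3 * K_grad M q) p
        = chi M p * (\<D>\<^sub>0 M p - \<D> M p)) \<and>
     (\<forall>j. \<forall>p\<in>phase_space M.
        \<partial>\<^sub>t (number_flux M j) p
        + (\<Sum>i\<in>UNIV. \<partial>\<^sub>x i (\<lambda>q. \<K> M q $ i $ j + vel M i q * \<I> M q $ j) p)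
        - 1 / (energy p)^2 * \<partial>\<^sub>\<epsilon> (\<lambda>q. (energy q)^3 * Q_grad M j q) p
        + (\<Sum>i\<in>UNIV. \<I> M p $ i * grad_vel M i j p)
        - Q_grad M j p
        = - kappa M p * \<I> M p $ j)"

definition energy_density :: "moment_data \<Rightarrow> phase \<Rightarrow> real" where
  "energy_density M p =
     energy p * (number_density M p + (\<Sum>i\<in>UNIV. vel M i p * number_flux M i p))"

definition momentum_density :: "moment_data \<Rightarrow> 3 \<Rightarrow> phase \<Rightarrow> real" where
  "momentum_density M j p = energy p * (number_flux M j p + vel M j p * number_density M p)"

definition stress :: "moment_data \<Rightarrow> 3 \<Rightarrow> 3 \<Rightarrow> phase \<Rightarrow> real" where
  "stress M i j p =
     energy p * (\<K> M p $ i $ j + \<I> M p $ i * vel M j p + vel M i p * \<I> M p $ j)"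

text \<open>
  Formal \<open>O(v\<^sup>2)\<close> terms. "Containing two velocity factors" is a property of an expression and not
  of the function it denotes, so sums of products are represented syntactically: a list of
  monomials, each an integer coefficient (covering signs and repetitions) with a list of factors.
  Derivatives of moments may have any order; \<open>\<D>\<^sub>0\<close>, which is not assumed differentiable,
  occurs undifferentiated only.
\<close>

datatype moment = M0 | M1 3 | M2 3 3 | M3 3 3 3

datatype factor =
    Vel 3
  | GradVel 3 3
  | EnergyFactor
  | Chi
  | Kappa
  | EqMoment
  | MomentDeriv "coordinate list" moment

type_synonym expression = "(int \<times> factor list) list"

fun moment_value :: "moment_data \<Rightarrow> moment \<Rightarrow> phase \<Rightarrow> real" where
  "moment_value M M0 p = \<D> M p"
| "moment_value M (M1 i) p = \<I> M p $ i"
| "moment_value M (M2 i j) p = \<K> M p $ i $ j"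
| "moment_value M (M3 i j k) p = \<Q> M p $ i $ j $ k"

fun factor_value :: "moment_data \<Rightarrow> factor \<Rightarrow> phase \<Rightarrow> real" where
  "factor_value M (Vel i) p = vel M i p"
| "factor_value M (GradVel i k) p = grad_vel M i k p"
| "factor_value M EnergyFactor p = energy p"
| "factor_value M Chi p = chi M p"
| "factor_value M Kappa p = kappa M p"
| "factor_value M EqMoment p = \<D>\<^sub>0 M p"
| "factor_value M (MomentDeriv cs m) p = foldr partial_deriv cs (moment_value M m) p"

definition expression_value :: "moment_data \<Rightarrow> expression \<Rightarrow> phase \<Rightarrow> real" where
  "expression_value M r p =
     (\<Sum>(c, fs)\<leftarrow>r. of_int c * (\<Prod>f\<leftarrow>fs. factor_value M f p))"

fun is_velocity_factor :: "factor \<Rightarrow> bool" where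
  "is_velocity_factor (Vel i) = True"
| "is_velocity_factor (GradVel i k) = True"
| "is_velocity_factor _ = False"

definition second_order_in_velocity :: "expression \<Rightarrow> bool" where
  "second_order_in_velocity r \<longleftrightarrow>
     (\<forall>(c, fs)\<in>set r. 2 \<le> length (filter is_velocity_factor fs))"

text \<open>
  The equation \<open>L = R\<close> holds, after dropping \<open>O(v\<^sup>2)\<close> terms, for all data satisfying \<open>C\<close>. One
  formal expression for the dropped terms has to serve all these data: if it could depend on the
  data, a particular function might be written with velocity factors by coincidence.
\<close>

definition eq_dropping_v2 ::
  "(moment_data \<Rightarrow> bool) \<Rightarrow> (moment_data \<Rightarrow> phase \<Rightarrow> real) \<Rightarrow> (moment_data \<Rightarrow> phase \<Rightarrow> real) \<Rightarrow> bool"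
  where
  "eq_dropping_v2 C L R \<longleftrightarrow>
     (\<exists>r. second_order_in_velocity r \<and>
        (\<forall>M. C M \<longrightarrow> (\<forall>p\<in>phase_space M. L M p = R M p + expression_value M r p)))"

definition phase_space_divergence ::
  "(phase \<Rightarrow> real) \<Rightarrow> (3 \<Rightarrow> phase \<Rightarrow> real) \<Rightarrow> (phase \<Rightarrow> real) \<Rightarrow> phase \<Rightarrow> real" where
  "phase_space_divergence u F F\<^sub>\<epsilon> p =
     \<partial>\<^sub>t u p + (\<Sum>i\<in>UNIV. \<partial>\<^sub>x i (F i) p)
     + 1 / (energy p)^2 * \<partial>\<^sub>\<epsilon> (\<lambda>q. (energy q)^2 * F\<^sub>\<epsilon> q) p"

definition conservation_law_dropping_v2 ::
  "(moment_data \<Rightarrow> bool) \<Rightarrow> (moment_data \<Rightarrow> phase \<Rightarrow> real) \<Rightarrow>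
   (moment_data \<Rightarrow> 3 \<Rightarrow> phase \<Rightarrow> real) \<Rightarrow> (moment_data \<Rightarrow> phase \<Rightarrow> real) \<Rightarrow> bool" where
  "conservation_law_dropping_v2 C u F F\<^sub>\<epsilon> \<longleftrightarrow>
     eq_dropping_v2 C (\<lambda>M. phase_space_divergence (u M) (F M) (F\<^sub>\<epsilon> M)) (\<lambda>M p. 0)"

definition collisionless :: "moment_data \<Rightarrow> bool" where
  "collisionless M \<longleftrightarrow> (\<forall>p\<in>phase_space M. chi M p = 0 \<and> kappa M p = 0)"

end

theory Submission
  imports Defs
begin

text \<open>
  Multiply the number equation by \<open>\<epsilon>\<close>, contract the flux equation with \<open>\<epsilon> v\<^sup>j\<close> and add: the time
  derivatives combine to \<open>\<partial>\<^sub>t \<E>\<close>, since the velocity is static. Multiply the flux equation by \<open>\<epsilon>\<close>, the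
  number equation by \<open>\<epsilon> v\<^sub>j\<close> and add: this gives \<open>\<partial>\<^sub>t \<P>\<^sub>j\<close>. What has to be seen is that all other
  terms of order zero and one in the velocity form a divergence or a collision term.

  Moving \<open>\<epsilon>\<close> under the energy derivative costs one term, because
  \<open>\<epsilon>\<^sup>-\<^sup>2 \<partial>\<^sub>\<epsilon>(\<epsilon>\<^sup>4 A) = \<epsilon> \<cdot> \<epsilon>\<^sup>-\<^sup>2 \<partial>\<^sub>\<epsilon>(\<epsilon>\<^sup>3 A) + \<epsilon> A\<close>. In the energy law the extra term is
  \<open>\<epsilon> \<K>\<^sup>i\<^sub>k \<partial>\<^sub>i v\<^sup>k\<close>. The flux \<open>\<P>\<^sup>i\<close> contains \<open>\<epsilon> v\<^sup>k \<K>\<^sub>k\<^sub>i\<close>, and by the symmetry of \<open>\<K>\<close> its divergence is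
  that same term plus \<open>\<epsilon> v\<^sup>k \<partial>\<^sub>i \<K>\<^sup>i\<^sub>k\<close>, which the contracted flux equation supplies. In the momentum law
  the extra term \<open>\<epsilon> \<Q>\<^sup>i\<^sub>k\<^sub>j \<partial>\<^sub>i v\<^sup>k\<close> is the source already present in the flux equation, and the other
  source \<open>\<I>\<^sup>i \<partial>\<^sub>i v\<^sub>j\<close> completes \<open>v\<^sub>j \<partial>\<^sub>i \<I>\<^sup>i\<close> to the divergence of the stress contribution \<open>\<I>\<^sup>i v\<^sub>j\<close>.

  In all that is left, an explicit velocity multiplies a term that already has a factor \<open>v\<close> or
  \<open>\<partial>v\<close>. These remainders are computed exactly, in \<open>energy_balance\<close> and \<open>momentum_balance\<close>; that they
  are formal expressions of second order follows from the calculus of \<open>velocity_order\<close>, in which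
  orders add under multiplication. Without collisions the right-hand sides vanish, so the
  conservation laws hold with the same remainders.
\<close>

section \<open>Partial derivatives as line derivatives\<close>

primrec coordinate_direction :: "coordinate \<Rightarrow> phase" where
  "coordinate_direction Energy = (1, 0, 0)"
| "coordinate_direction (Position i) = (0, axis i 1, 0)"
| "coordinate_direction Time = (0, 0, 1)"

text \<open>The derivative along the coordinate line through \<open>p\<close>, as a relation: it states existence and value
  together, so the product and sum rules need no separate differentiability premises.\<close>

definition has_partial_deriv :: "coordinate \<Rightarrow> (phase \<Rightarrow> real) \<Rightarrow> real \<Rightarrow> phase \<Rightarrow> bool" where
  "has_partial_deriv c f f' p \<longleftrightarrow>
     ((\<lambda>s. f (p + s *\<^sub>R coordinate_direction c)) has_real_derivative f') (at 0)"

lemma partial_deriv_eq_line_deriv: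
  "partial_deriv c f p = deriv (\<lambda>s. f (p + s *\<^sub>R coordinate_direction c)) 0"
proof -
  obtain e x t where p: "p = (e, x, t)" by (cases p)
  have shift: "deriv h a = deriv (\<lambda>s. h (a + s)) 0" for h :: "real \<Rightarrow> real" and a
    unfolding deriv_def using DERIV_shift[of h _ 0 a] by (simp only: add.commute[of a] add_0)
  show ?thesis
    by (cases c) (simp_all add: p shift[of _ e] shift[of _ t])
qed

lemma has_partial_derivD: "has_partial_deriv c f f' p \<Longrightarrow> partial_deriv c f p = f'"
  by (simp add: has_partial_deriv_def partial_deriv_eq_line_deriv DERIV_imp_deriv)

lemma has_partial_deriv_of_differentiable:
  assumes "f differentiable (at p)"
  shows "has_partial_deriv c f (partial_deriv c f p) p"
proof -
  let ?line = "\<lambda>s. p + s *\<^sub>R coordinate_direction c"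
  have "(\<lambda>s. f (?line s)) differentiable (at 0)"
    using differentiable_chain_at[of ?line 0 f] assms by (simp add: o_def)
  then obtain d where "((\<lambda>s. f (?line s)) has_real_derivative d) (at 0)"
    unfolding real_differentiable_def ..
  then show ?thesis
    by (simp add: has_partial_deriv_def partial_deriv_eq_line_deriv DERIV_imp_deriv)
qed

lemma has_partial_deriv_add:
  "has_partial_deriv c f f' p \<Longrightarrow> has_partial_deriv c g g' p \<Longrightarrow>
   has_partial_deriv c (\<lambda>q. f q + g q) (f' + g') p"
  unfolding has_partial_deriv_def by (rule DERIV_add)

lemma has_partial_deriv_minus:
  "has_partial_deriv c f f' p \<Longrightarrow> has_partial_deriv c (\<lambda>q. - f q) (- f') p"
  unfolding has_partial_deriv_def by (rule DERIV_minus)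

lemma has_partial_deriv_mult:
  "has_partial_deriv c f f' p \<Longrightarrow> has_partial_deriv c g g' p \<Longrightarrow>
   has_partial_deriv c (\<lambda>q. f q * g q) (f' * g p + f p * g') p"
  unfolding has_partial_deriv_def
  by (auto intro!: derivative_eq_intros)

lemma has_partial_deriv_sum:
  "(\<And>i. i \<in> A \<Longrightarrow> has_partial_deriv c (f i) (f' i) p) \<Longrightarrow>
   has_partial_deriv c (\<lambda>q. \<Sum>i\<in>A. f i q) (\<Sum>i\<in>A. f' i) p"
  unfolding has_partial_deriv_def by (rule DERIV_sum)

lemma has_partial_deriv_energy_power:
  "has_partial_deriv Energy (\<lambda>q. energy q ^ n) (real n * energy p ^ (n - 1)) p"
  unfolding has_partial_deriv_def
  by (auto intro!: derivative_eq_intros)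

lemma has_partial_deriv_along_constant:
  assumes "\<And>s. f (p + s *\<^sub>R coordinate_direction c) = f p"
  shows "has_partial_deriv c f 0 p"
  unfolding has_partial_deriv_def assms by simp

lemma has_partial_deriv_energy_0:
  "c \<noteq> Energy \<Longrightarrow> has_partial_deriv c energy 0 p"
  by (rule has_partial_deriv_along_constant) (cases c; simp)

text \<open>The velocity and its gradient depend on the position alone, so they pass through energy and time
  derivatives like constants.\<close>

lemma has_partial_deriv_static:
  assumes "\<And>q q'. position q = position q' \<Longrightarrow> f q = f q'"
    and "c = Energy \<or> c = Time"
  shows "has_partial_deriv c f 0 p"
  by (rule has_partial_deriv_along_constant, rule assms(1)) (use assms(2) in auto)

lemma grad_vel_static:
  "position q = position q' \<Longrightarrow> grad_vel M i k q = grad_vel M i k q'"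
  by (cases q; cases q') (simp add: grad_vel_def vel_def)

text \<open>The instances \<open>n = 3\<close> and \<open>n = 4\<close> are the energy fluxes of the model and of the conservation laws.\<close>

lemma energy_deriv_power_contraction:
  assumes "\<And>i k. (T i k) differentiable (at p)"
  shows "has_partial_deriv Energy
    (\<lambda>q. energy q ^ n * (\<Sum>i\<in>UNIV. \<Sum>k\<in>UNIV. T i k q * grad_vel M i k q))
    (real n * energy p ^ (n - 1) * (\<Sum>i\<in>UNIV. \<Sum>k\<in>UNIV. T i k p * grad_vel M i k p)
     + energy p ^ n * (\<Sum>i\<in>UNIV. \<Sum>k\<in>UNIV. \<partial>\<^sub>\<epsilon> (T i k) p * grad_vel M i k p)) p"
proof -
  have "has_partial_deriv Energy (grad_vel M i k) 0 p" for i k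
    by (rule has_partial_deriv_static, erule grad_vel_static) simp
  then have "has_partial_deriv Energy (\<lambda>q. T i k q * grad_vel M i k q)
      (\<partial>\<^sub>\<epsilon> (T i k) p * grad_vel M i k p) p" for i k
    using has_partial_deriv_mult[OF has_partial_deriv_of_differentiable[OF assms], of Energy "grad_vel M i k" 0 i k]
    by simp
  then show ?thesis
    by (intro has_partial_deriv_mult has_partial_deriv_energy_power has_partial_deriv_sum)
qed

text \<open>A conservation law carries its energy flux as \<open>\<epsilon>\<^sup>-\<^sup>2 \<partial>\<^sub>\<epsilon>(\<epsilon>\<^sup>2 F)\<close>; here \<open>F = - \<epsilon>\<^sup>2 T\<close>, which turns it into
  the form \<open>- \<epsilon>\<^sup>-\<^sup>2 \<partial>\<^sub>\<epsilon>(\<epsilon>\<^sup>4 T)\<close> of the balance equations.\<close>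

lemma minus_energy_flux_deriv:
  assumes "has_partial_deriv Energy (\<lambda>q. (energy q)^4 * T q) d p"
  shows "\<partial>\<^sub>\<epsilon> (\<lambda>q. (energy q)^2 * - ((energy q)^2 * T q)) p = - \<partial>\<^sub>\<epsilon> (\<lambda>q. (energy q)^4 * T q) p"
proof -
  have "(\<lambda>q::phase. (energy q)^2 * - ((energy q)^2 * T q)) = (\<lambda>q. - ((energy q)^4 * T q))"
    by (simp add: fun_eq_iff flip: mult.assoc power_add)
  then show ?thesis
    using has_partial_derivD[OF assms] has_partial_derivD[OF has_partial_deriv_minus[OF assms]]
    by simp
qed

section \<open>Differentiability of the moments and of the velocity\<close>

lemma smooth_on_imp_differentiable:
  assumes "smooth_on S f" "p \<in> S"
  shows "f differentiable (at p)"
proof -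
  have "times_differentiable_on (Suc 0) S f"
    using assms(1) unfolding smooth_on_def by blast
  with assms(2) show ?thesis by simp
qed

lemma differentiable_vec_nth:
  "f differentiable (at p) \<Longrightarrow> (\<lambda>q. f q $ i) differentiable (at p)"
  using differentiable_compose[of "\<lambda>x. x $ i" f p UNIV]
  by (simp add: bounded_linear_imp_differentiable bounded_linear_vec_nth)

lemma moment_value_fun:
  "moment_value M M0 = \<D> M"
  "moment_value M (M1 i) = (\<lambda>q. \<I> M q $ i)"
  "moment_value M (M2 i j) = (\<lambda>q. \<K> M q $ i $ j)"
  "moment_value M (M3 i j k) = (\<lambda>q. \<Q> M q $ i $ j $ k)"
  by (simp_all add: fun_eq_iff)

lemma moment_differentiable:
  assumes "admissible M" "p \<in> phase_space M"
  shows "moment_value M m differentiable (at p)"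
proof -
  have "\<D> M differentiable (at p)" "\<I> M differentiable (at p)"
    "\<K> M differentiable (at p)" "\<Q> M differentiable (at p)"
    using assms unfolding admissible_def by (auto intro: smooth_on_imp_differentiable)
  then show ?thesis
    by (cases m) (simp_all add: moment_value_fun differentiable_vec_nth)
qed

lemma vel_differentiable:
  assumes "admissible M"
  shows "vel M k differentiable (at p)"
proof -
  have "velocity M differentiable (at (position p))"
    using assms unfolding admissible_def by (auto intro: smooth_on_imp_differentiable)
  moreover have "position differentiable (at p)"
    by (intro bounded_linear_imp_differentiable bounded_linear_compose[OF bounded_linear_fst]
        bounded_linear_snd)
  ultimately have "(\<lambda>q. velocity M (position q)) differentiable (at p)"
    using differentiable_chain_at[of position p "velocity M"] by (simp add: o_def)
  then show ?thesis
    unfolding vel_def[abs_def] by (rule differentiable_vec_nth)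
qed

section \<open>Formal order in the velocity\<close>

text \<open>A quantity has order \<open>n\<close> if one formal expression represents it for all data, and each monomial of
  that expression has at least \<open>n\<close> velocity factors. With \<open>n\<close> as a parameter the notion is compositional:
  an expression of second order is reached as a product of two of first order.\<close>

definition velocity_order :: "nat \<Rightarrow> (moment_data \<Rightarrow> phase \<Rightarrow> real) \<Rightarrow> bool" where
  "velocity_order n F \<longleftrightarrow>
     (\<exists>r. (\<forall>(c, fs)\<in>set r. n \<le> length (filter is_velocity_factor fs)) \<and>
          (\<forall>M p. F M p = expression_value M r p))"

lemma velocity_orderI:
  assumes "\<And>c fs. (c, fs) \<in> set r \<Longrightarrow> n \<le> length (filter is_velocity_factor fs)"
    and "\<And>M p. F M p = expression_value M r p"
  shows "velocity_order n F"
  unfolding velocity_order_def using assms by (intro exI[of _ r]) auto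

lemma velocity_orderE:
  assumes "velocity_order n F"
  obtains r where "\<And>c fs. (c, fs) \<in> set r \<Longrightarrow> n \<le> length (filter is_velocity_factor fs)"
    and "\<And>M p. F M p = expression_value M r p"
  using assms unfolding velocity_order_def by fast

lemma expression_value_Cons:
  "expression_value M ((c, fs) # r) p =
     of_int c * (\<Prod>f\<leftarrow>fs. factor_value M f p) + expression_value M r p"
  by (simp add: expression_value_def)

lemma expression_value_append:
  "expression_value M (r @ s) p = expression_value M r p + expression_value M s p"
  by (simp add: expression_value_def)

lemma velocity_order_factor:
  "velocity_order (if is_velocity_factor f then 1 else 0) (\<lambda>M p. factor_value M f p)"
  by (rule velocity_orderI[of "[(1, [f])]"]) (auto simp: expression_value_def split: if_splits)

lemma velocity_order_const: "velocity_order 0 (\<lambda>M p. of_int c)"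
  by (rule velocity_orderI[of "[(c, [])]"]) (auto simp: expression_value_def)

lemma velocity_order_zero: "velocity_order n (\<lambda>M p. 0)"
  by (rule velocity_orderI[of "[]"]) (auto simp: expression_value_def)

lemma velocity_order_add:
  assumes "velocity_order n F" "velocity_order n G"
  shows "velocity_order n (\<lambda>M p. F M p + G M p)"
proof -
  obtain r where r: "\<And>c fs. (c, fs) \<in> set r \<Longrightarrow> n \<le> length (filter is_velocity_factor fs)"
      "\<And>M p. F M p = expression_value M r p"
    using assms(1) by (rule velocity_orderE) blast
  obtain s where s: "\<And>c fs. (c, fs) \<in> set s \<Longrightarrow> n \<le> length (filter is_velocity_factor fs)"
      "\<And>M p. G M p = expression_value M s p"
    using assms(2) by (rule velocity_orderE) blast
  show ?thesis
    by (rule velocity_orderI[of "r @ s"]) (auto simp: expression_value_append r s)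
qed

text \<open>Expressions multiply monomial by monomial, concatenating the lists of factors. The velocity
  factors of the two monomials therefore add up, which is why orders do.\<close>

lemma expression_value_product:
  "expression_value M [(c * d, fs @ gs). (c, fs) \<leftarrow> r, (d, gs) \<leftarrow> s] p =
     expression_value M r p * expression_value M s p"
proof -
  have "expression_value M (map (\<lambda>(d, gs). (c * d, fs @ gs)) s) p =
      of_int c * (\<Prod>f\<leftarrow>fs. factor_value M f p) * expression_value M s p" for c fs
    by (induction s) (auto simp: expression_value_def algebra_simps)
  then show ?thesis
    by (induction r)
      (auto simp: expression_value_append expression_value_Cons algebra_simps,
       simp add: expression_value_def)
qed

lemma velocity_order_mult:
  assumes "velocity_order m F" "velocity_order n G"
  shows "velocity_order (m + n) (\<lambda>M p. F M p * G M p)"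
proof -
  obtain r where r: "\<And>c fs. (c, fs) \<in> set r \<Longrightarrow> m \<le> length (filter is_velocity_factor fs)"
      "\<And>M p. F M p = expression_value M r p"
    using assms(1) by (rule velocity_orderE) blast
  obtain s where s: "\<And>c fs. (c, fs) \<in> set s \<Longrightarrow> n \<le> length (filter is_velocity_factor fs)"
      "\<And>M p. G M p = expression_value M s p"
    using assms(2) by (rule velocity_orderE) blast
  show ?thesis
    by (rule velocity_orderI[of "[(c * d, fs @ gs). (c, fs) \<leftarrow> r, (d, gs) \<leftarrow> s]"])
      (auto simp: expression_value_product r(2) s(2) intro!: add_mono r(1) s(1))
qed

lemma velocity_order_sum:
  assumes "\<And>i. i \<in> A \<Longrightarrow> velocity_order n (F i)"
  shows "velocity_order n (\<lambda>M p. \<Sum>i\<in>A. F i M p)"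
  using assms
  by (induction A rule: infinite_finite_induct)
    (simp_all add: velocity_order_zero velocity_order_add)

lemma velocity_order_minus:
  assumes "velocity_order n F"
  shows "velocity_order n (\<lambda>M p. - F M p)"
  using velocity_order_mult[OF velocity_order_const[of "-1"] assms] by simp

lemma velocity_order_vel: "velocity_order 1 (\<lambda>M. vel M i)"
  using velocity_order_factor[of "Vel i"] by simp

lemma velocity_order_grad_vel: "velocity_order 1 (\<lambda>M. grad_vel M i k)"
  using velocity_order_factor[of "GradVel i k"] by simp

lemma velocity_order_energy: "velocity_order 0 (\<lambda>M. energy)"
  using velocity_order_factor[of EnergyFactor] by simp

lemma velocity_order_moment: "velocity_order 0 (\<lambda>M p. moment_value M m p)"
  using velocity_order_factor[of "MomentDeriv [] m"] by simp

lemma velocity_order_moment_deriv: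
  "velocity_order 0 (\<lambda>M p. partial_deriv c (moment_value M m) p)"
  using velocity_order_factor[of "MomentDeriv [c] m"] by simp

lemmas velocity_order_moments =
  velocity_order_moment[of M0, unfolded moment_value.simps]
  velocity_order_moment[of "M1 i" for i, unfolded moment_value.simps]
  velocity_order_moment[of "M2 i j" for i j, unfolded moment_value.simps]
  velocity_order_moment[of "M3 i j k" for i j k, unfolded moment_value.simps]
  velocity_order_moment_deriv[of _ M0, unfolded moment_value_fun]
  velocity_order_moment_deriv[of _ "M2 i j" for i j, unfolded moment_value_fun]
  velocity_order_moment_deriv[of _ "M3 i j k" for i j k, unfolded moment_value_fun]

lemma velocity_order_scale:
  "velocity_order 0 F \<Longrightarrow> velocity_order n G \<Longrightarrow> velocity_order n (\<lambda>M p. F M p * G M p)"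
  using velocity_order_mult[of 0 F n G] by simp

lemma velocity_order_contraction:
  assumes "\<And>i k. velocity_order 0 (T i k)"
  shows "velocity_order 1 (\<lambda>M p. \<Sum>i\<in>UNIV. \<Sum>k\<in>UNIV. T i k M p * grad_vel M i k p)"
  by (intro velocity_order_sum velocity_order_scale velocity_order_grad_vel assms)

lemma velocity_order_mult_moment:
  "velocity_order 1 F \<Longrightarrow> velocity_order 0 G \<Longrightarrow> velocity_order 1 (\<lambda>M p. F M p * G M p)"
  using velocity_order_mult[of 1 F 0 G] by simp

lemma velocity_order_numeral: "velocity_order 0 (\<lambda>M p. numeral w)"
  using velocity_order_const[of "numeral w"] by simp

lemma velocity_order_2I:
  "velocity_order 1 F \<Longrightarrow> velocity_order 1 G \<Longrightarrow> velocity_order 2 (\<lambda>M p. F M p * G M p)"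
  using velocity_order_mult[of 1 F 1 G] by (simp add: numeral_2_eq_2)

lemma eq_dropping_v2I:
  assumes "velocity_order 2 F"
    and "\<And>M p. C M \<Longrightarrow> p \<in> phase_space M \<Longrightarrow> L M p = R M p + F M p"
  shows "eq_dropping_v2 C L R"
  using assms unfolding velocity_order_def eq_dropping_v2_def second_order_in_velocity_def
  by metis

section \<open>The terms of second order that are dropped\<close>

text \<open>What the energy law leaves over. The first sum comes from \<open>\<partial>\<^sub>i(\<epsilon> v\<^sup>i v\<^sup>k \<I>\<^sub>k)\<close> in the divergence of the
  momentum; the terms of that divergence in which \<open>\<partial>\<^sub>i\<close> acts on \<open>v\<^sup>i\<close> or on \<open>\<I>\<^sub>k\<close> cancel against
  \<open>v\<^sup>j \<partial>\<^sub>i(v\<^sup>i \<I>\<^sub>j)\<close>. The other two come from the source and energy flux terms of the flux equation,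
  contracted with the velocity: the coefficient 4 is 3 from \<open>\<partial>\<^sub>\<epsilon> \<epsilon>\<^sup>3\<close> and 1 from the source.
  Energy derivatives are carried out here because formal expressions may differentiate moments only.\<close>

definition energy_remainder :: "moment_data \<Rightarrow> phase \<Rightarrow> real" where
  "energy_remainder M p = energy p * (
     (\<Sum>i\<in>UNIV. \<Sum>k\<in>UNIV. vel M i p * (grad_vel M i k p * \<I> M p $ k))
     + - (\<Sum>j\<in>UNIV. \<Sum>i\<in>UNIV. vel M j p * (grad_vel M i j p * \<I> M p $ i))
     + (\<Sum>j\<in>UNIV. vel M j p * (4 * Q_grad M j p
         + energy p * (\<Sum>i\<in>UNIV. \<Sum>k\<in>UNIV.
             \<partial>\<^sub>\<epsilon> (\<lambda>q. \<Q> M q $ i $ k $ j) p * grad_vel M i k p))))"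

text \<open>What the momentum law leaves over: \<open>\<epsilon> v\<^sub>j\<close> times those terms of the number equation, solved for
  \<open>\<partial>\<^sub>t \<N>\<close>, that contain the velocity, namely \<open>- \<partial>\<^sub>i(v\<^sup>i \<D>)\<close> and the energy flux.\<close>

definition momentum_remainder :: "3 \<Rightarrow> moment_data \<Rightarrow> phase \<Rightarrow> real" where
  "momentum_remainder j M p = energy p * (vel M j p * (
     - (\<Sum>i\<in>UNIV. grad_vel M i i p * \<D> M p)
     + - (\<Sum>i\<in>UNIV. vel M i p * \<partial>\<^sub>x i (\<D> M) p)
     + 3 * K_grad M p
     + energy p * (\<Sum>i\<in>UNIV. \<Sum>k\<in>UNIV.
         \<partial>\<^sub>\<epsilon> (\<lambda>q. \<K> M q $ i $ k) p * grad_vel M i k p)))"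

lemma velocity_order_energy_remainder: "velocity_order 2 energy_remainder"
  unfolding energy_remainder_def[abs_def] Q_grad_def
  by (intro velocity_order_scale[OF velocity_order_energy] velocity_order_add velocity_order_minus
      velocity_order_scale[OF velocity_order_numeral] velocity_order_contraction
      velocity_order_2I velocity_order_mult_moment
      velocity_order_sum velocity_order_vel velocity_order_grad_vel velocity_order_moments)

lemma velocity_order_momentum_remainder: "velocity_order 2 (momentum_remainder j)"
  unfolding momentum_remainder_def[abs_def] K_grad_def
  by (intro velocity_order_scale[OF velocity_order_energy] velocity_order_2I velocity_order_add
      velocity_order_minus velocity_order_scale[OF velocity_order_numeral]
      velocity_order_contraction velocity_order_mult_moment
      velocity_order_sum velocity_order_vel velocity_order_grad_vel velocity_order_moments)

section \<open>The balance equations with their remainders\<close>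

context
  fixes M :: moment_data and p :: phase
  assumes model: "two_moment_model M" and p: "p \<in> phase_space M"
begin

lemma model_admissible: "admissible M"
  using model by (simp add: two_moment_model_def)

lemma energy_positive: "0 < energy p"
  using p by (auto simp: phase_space_def)

lemma number_equation:
  "\<partial>\<^sub>t (number_density M) p
     + (\<Sum>i\<in>UNIV. \<partial>\<^sub>x i (\<lambda>q. \<I> M q $ i + vel M i q * \<D> M q) p)
     - 1 / (energy p)^2 * \<partial>\<^sub>\<epsilon> (\<lambda>q. (energy q)^3 * K_grad M q) p
   = chi M p * (\<D>\<^sub>0 M p - \<D> M p)"
  using model p unfolding two_moment_model_def by blast

lemma flux_equation:
  "\<partial>\<^sub>t (number_flux M j) p
     + (\<Sum>i\<in>UNIV. \<partial>\<^sub>x i (\<lambda>q. \<K> M q $ i $ j + vel M i q * \<I> M q $ j) p)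
     - 1 / (energy p)^2 * \<partial>\<^sub>\<epsilon> (\<lambda>q. (energy q)^3 * Q_grad M j q) p
     + (\<Sum>i\<in>UNIV. \<I> M p $ i * grad_vel M i j p) - Q_grad M j p
   = - kappa M p * \<I> M p $ j"
  using model p unfolding two_moment_model_def by blast

lemma K_sym: "\<K> M p $ i $ j = \<K> M p $ j $ i"
  using model_admissible p by (auto simp: admissible_def)

lemma moments_differentiable:
  "\<D> M differentiable (at p)" "(\<lambda>q. \<I> M q $ i) differentiable (at p)"
  "(\<lambda>q. \<K> M q $ i $ j) differentiable (at p)"
  "(\<lambda>q. \<Q> M q $ i $ j $ k) differentiable (at p)"
  using moment_differentiable[OF model_admissible p, of M0]
    moment_differentiable[OF model_admissible p, of "M1 i"]
    moment_differentiable[OF model_admissible p, of "M2 i j"]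
    moment_differentiable[OF model_admissible p, of "M3 i j k"]
  by (simp_all add: moment_value_fun)

lemmas moment_partials = moments_differentiable[THEN has_partial_deriv_of_differentiable]

lemma vel_partials:
  "has_partial_deriv (Position i) (vel M k) (grad_vel M i k p) p"
  "has_partial_deriv Time (vel M k) 0 p"
  unfolding grad_vel_def
  by (rule has_partial_deriv_of_differentiable[OF vel_differentiable[OF model_admissible]],
      rule has_partial_deriv_static) (simp_all add: vel_def)

lemmas partial_intros =
  moment_partials vel_partials has_partial_deriv_energy_0 has_partial_deriv_add
  has_partial_deriv_mult has_partial_deriv_sum

text \<open>The symmetry of \<open>\<K>\<close> is given on phase space only. It may be differentiated along a spatial direction
  because phase space contains the entire spatial line through each of its points.\<close>

lemma K_deriv_sym:
  "\<partial>\<^sub>x l (\<lambda>q. \<K> M q $ i $ j) p = \<partial>\<^sub>x l (\<lambda>q. \<K> M q $ j $ i) p"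
proof -
  have "p + s *\<^sub>R coordinate_direction (Position l) \<in> phase_space M" for s
    using p by (auto simp: phase_space_def)
  then have "\<K> M (p + s *\<^sub>R coordinate_direction (Position l)) $ i $ j
      = \<K> M (p + s *\<^sub>R coordinate_direction (Position l)) $ j $ i" for s
    using model_admissible unfolding admissible_def by blast
  then show ?thesis
    unfolding partial_deriv_eq_line_deriv by (simp only:)
qed

lemma number_density_differentiable: "number_density M differentiable (at p)"
  unfolding number_density_def[abs_def]
  by (intro differentiable_add differentiable_sum differentiable_mult moments_differentiable
      vel_differentiable[OF model_admissible] finite ballI)

lemma number_flux_differentiable: "number_flux M j differentiable (at p)"
  unfolding number_flux_def[abs_def]
  by (intro differentiable_add differentiable_sum differentiable_mult moments_differentiable
      vel_differentiable[OF model_admissible] finite ballI)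

lemmas number_partials =
  number_density_differentiable[THEN has_partial_deriv_of_differentiable]
  number_flux_differentiable[THEN has_partial_deriv_of_differentiable]

lemma dT_energy_density:
  "\<partial>\<^sub>t (energy_density M) p = energy p * (\<partial>\<^sub>t (number_density M) p
     + (\<Sum>j\<in>UNIV. vel M j p * \<partial>\<^sub>t (number_flux M j) p))"
proof -
  (* The value has exactly the shape that the product and sum rules produce, including the zero
     terms from the energy and the static velocity; this lets the rules apply without rewriting.
     The derivatives below are computed in the same way. *)
  have "has_partial_deriv Time (energy_density M)
    (0 * (number_density M p + (\<Sum>i\<in>UNIV. vel M i p * number_flux M i p))
     + energy p * (\<partial>\<^sub>t (number_density M) p
         + (\<Sum>j\<in>UNIV. 0 * number_flux M j p + vel M j p * \<partial>\<^sub>t (number_flux M j) p))) p"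
    unfolding energy_density_def[abs_def]
    by (intro partial_intros number_partials) simp
  from has_partial_derivD[OF this] show ?thesis by simp
qed

lemma dT_momentum_density:
  "\<partial>\<^sub>t (momentum_density M j) p = energy p * (\<partial>\<^sub>t (number_flux M j) p
     + vel M j p * \<partial>\<^sub>t (number_density M) p)"
proof -
  have "has_partial_deriv Time (momentum_density M j)
    (0 * (number_flux M j p + vel M j p * number_density M p)
     + energy p * (\<partial>\<^sub>t (number_flux M j) p
         + (0 * number_density M p + vel M j p * \<partial>\<^sub>t (number_density M) p))) p"
    unfolding momentum_density_def[abs_def]
    by (intro partial_intros number_partials) simp
  from has_partial_derivD[OF this] show ?thesis by simp
qed

lemma dX_momentum_density:
  "\<partial>\<^sub>x i (momentum_density M j) p = energy p *
     ((\<partial>\<^sub>x i (\<lambda>q. \<I> M q $ j) p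
       + (\<Sum>k\<in>UNIV. grad_vel M i k p * \<K> M p $ k $ j + vel M k p * \<partial>\<^sub>x i (\<lambda>q. \<K> M q $ k $ j) p))
      + (grad_vel M i j p * number_density M p
         + vel M j p * (\<partial>\<^sub>x i (\<D> M) p
           + (\<Sum>k\<in>UNIV. grad_vel M i k p * \<I> M p $ k + vel M k p * \<partial>\<^sub>x i (\<lambda>q. \<I> M q $ k) p))))"
  (is "_ = energy p * ?d")
proof -
  have "has_partial_deriv (Position i) (momentum_density M j)
    (0 * (number_flux M j p + vel M j p * number_density M p) + energy p * ?d) p"
    unfolding momentum_density_def[abs_def] number_flux_def number_density_def
    by (intro partial_intros) simp
  from has_partial_derivD[OF this] show ?thesis by simp
qed

lemma dX_stress:
  "\<partial>\<^sub>x i (stress M i j) p = energy p * (\<partial>\<^sub>x i (\<lambda>q. \<K> M q $ i $ j) p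
     + (\<partial>\<^sub>x i (\<lambda>q. \<I> M q $ i) p * vel M j p + \<I> M p $ i * grad_vel M i j p)
     + (grad_vel M i i p * \<I> M p $ j + vel M i p * \<partial>\<^sub>x i (\<lambda>q. \<I> M q $ j) p))"
  (is "_ = energy p * ?d")
proof -
  have "has_partial_deriv (Position i) (stress M i j)
    (0 * (\<K> M p $ i $ j + \<I> M p $ i * vel M j p + vel M i p * \<I> M p $ j) + energy p * ?d) p"
    unfolding stress_def[abs_def]
    by (intro partial_intros) simp
  from has_partial_derivD[OF this] show ?thesis by simp
qed

lemma dX_number_equation_flux:
  "\<partial>\<^sub>x i (\<lambda>q. \<I> M q $ i + vel M i q * \<D> M q) p =
     \<partial>\<^sub>x i (\<lambda>q. \<I> M q $ i) p + (grad_vel M i i p * \<D> M p + vel M i p * \<partial>\<^sub>x i (\<D> M) p)"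
  by (rule has_partial_derivD) (intro partial_intros)

lemma dX_flux_equation_flux:
  "\<partial>\<^sub>x i (\<lambda>q. \<K> M q $ i $ j + vel M i q * \<I> M q $ j) p =
     \<partial>\<^sub>x i (\<lambda>q. \<K> M q $ i $ j) p
     + (grad_vel M i i p * \<I> M p $ j + vel M i p * \<partial>\<^sub>x i (\<lambda>q. \<I> M q $ j) p)"
  by (rule has_partial_derivD) (intro partial_intros)

abbreviation "dE_K_grad \<equiv> \<Sum>i\<in>UNIV. \<Sum>k\<in>UNIV. \<partial>\<^sub>\<epsilon> (\<lambda>q. \<K> M q $ i $ k) p * grad_vel M i k p"
abbreviation "dE_Q_grad j \<equiv> \<Sum>i\<in>UNIV. \<Sum>k\<in>UNIV. \<partial>\<^sub>\<epsilon> (\<lambda>q. \<Q> M q $ i $ k $ j) p * grad_vel M i k p"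

lemma energy_deriv_power_K_grad:
  "has_partial_deriv Energy (\<lambda>q. energy q ^ n * K_grad M q)
     (real n * energy p ^ (n - 1) * K_grad M p + energy p ^ n * dE_K_grad) p"
  unfolding K_grad_def by (intro energy_deriv_power_contraction moments_differentiable)

lemma energy_deriv_power_Q_grad:
  "has_partial_deriv Energy (\<lambda>q. energy q ^ n * Q_grad M j q)
     (real n * energy p ^ (n - 1) * Q_grad M j p + energy p ^ n * dE_Q_grad j) p"
  unfolding Q_grad_def by (intro energy_deriv_power_contraction moments_differentiable)

lemma dT_number_density:
  "\<partial>\<^sub>t (number_density M) p = chi M p * (\<D>\<^sub>0 M p - \<D> M p) + 3 * K_grad M p + energy p * dE_K_grad
     - (\<Sum>i\<in>UNIV. \<partial>\<^sub>x i (\<lambda>q. \<I> M q $ i) p + (grad_vel M i i p * \<D> M p + vel M i p * \<partial>\<^sub>x i (\<D> M) p))"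
proof -
  have "1 / (energy p)^2 * \<partial>\<^sub>\<epsilon> (\<lambda>q. (energy q)^3 * K_grad M q) p = 3 * K_grad M p + energy p * dE_K_grad"
    unfolding has_partial_derivD[OF energy_deriv_power_K_grad]
    using energy_positive by (simp add: field_simps power2_eq_square power3_eq_cube)
  with number_equation show ?thesis
    unfolding dX_number_equation_flux by linarith
qed

lemma dT_number_flux:
  "\<partial>\<^sub>t (number_flux M j) p = - kappa M p * \<I> M p $ j + 4 * Q_grad M j p + energy p * dE_Q_grad j
     - (\<Sum>i\<in>UNIV. \<I> M p $ i * grad_vel M i j p)
     - (\<Sum>i\<in>UNIV. \<partial>\<^sub>x i (\<lambda>q. \<K> M q $ i $ j) p
     + (grad_vel M i i p * \<I> M p $ j + vel M i p * \<partial>\<^sub>x i (\<lambda>q. \<I> M q $ j) p))"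
proof -
  have "1 / (energy p)^2 * \<partial>\<^sub>\<epsilon> (\<lambda>q. (energy q)^3 * Q_grad M j q) p = 3 * Q_grad M j p + energy p * dE_Q_grad j"
    unfolding has_partial_derivD[OF energy_deriv_power_Q_grad]
    using energy_positive by (simp add: field_simps power2_eq_square power3_eq_cube)
  with flux_equation[of j] show ?thesis
    unfolding dX_flux_equation_flux by linarith
qed

text \<open>The term \<open>K_grad\<close> arises here, from the derivative of the velocity in \<open>\<partial>\<^sub>i(v\<^sup>k \<K>\<^sub>k\<^sub>i)\<close>; it will absorb the
  one produced by moving \<open>\<epsilon>\<close> under the energy derivative. The sums are arranged so that those with an
  outer factor \<open>vel M j p\<close> match \<open>vel_dT_number_flux\<close>.\<close>

lemma momentum_divergence:
  "(\<Sum>i\<in>UNIV. \<partial>\<^sub>x i (momentum_density M i) p) = energy p *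
     ((\<Sum>i\<in>UNIV. \<partial>\<^sub>x i (\<lambda>q. \<I> M q $ i) p)
      + K_grad M p
      + (\<Sum>j\<in>UNIV. vel M j p * (\<Sum>i\<in>UNIV. \<partial>\<^sub>x i (\<lambda>q. \<K> M q $ i $ j) p))
      + (\<Sum>i\<in>UNIV. grad_vel M i i p) * number_density M p
      + (\<Sum>i\<in>UNIV. vel M i p * \<partial>\<^sub>x i (\<D> M) p)
      + (\<Sum>i\<in>UNIV. \<Sum>k\<in>UNIV. vel M i p * (grad_vel M i k p * \<I> M p $ k))
      + (\<Sum>j\<in>UNIV. vel M j p * (\<Sum>i\<in>UNIV. vel M i p * \<partial>\<^sub>x i (\<lambda>q. \<I> M q $ j) p)))"
proof -
  have K: "(\<Sum>i\<in>UNIV. \<Sum>k\<in>UNIV. grad_vel M i k p * \<K> M p $ k $ i) = K_grad M p"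
    by (simp add: K_grad_def K_sym mult.commute)
  have dK: "(\<Sum>i\<in>UNIV. \<Sum>k\<in>UNIV. vel M k p * \<partial>\<^sub>x i (\<lambda>q. \<K> M q $ k $ i) p)
      = (\<Sum>j\<in>UNIV. vel M j p * (\<Sum>i\<in>UNIV. \<partial>\<^sub>x i (\<lambda>q. \<K> M q $ i $ j) p))"
    unfolding sum_distrib_left by (subst sum.swap) (simp only: K_deriv_sym)
  have dI: "(\<Sum>i\<in>UNIV. \<Sum>k\<in>UNIV. vel M i p * (vel M k p * \<partial>\<^sub>x i (\<lambda>q. \<I> M q $ k) p))
      = (\<Sum>j\<in>UNIV. vel M j p * (\<Sum>i\<in>UNIV. vel M i p * \<partial>\<^sub>x i (\<lambda>q. \<I> M q $ j) p))"
    unfolding sum_distrib_left by (subst sum.swap) (simp only: mult.left_commute)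
  have "(\<Sum>i\<in>UNIV. \<partial>\<^sub>x i (momentum_density M i) p) = energy p *
     ((\<Sum>i\<in>UNIV. \<partial>\<^sub>x i (\<lambda>q. \<I> M q $ i) p)
      + ((\<Sum>i\<in>UNIV. \<Sum>k\<in>UNIV. grad_vel M i k p * \<K> M p $ k $ i)
         + (\<Sum>i\<in>UNIV. \<Sum>k\<in>UNIV. vel M k p * \<partial>\<^sub>x i (\<lambda>q. \<K> M q $ k $ i) p))
      + ((\<Sum>i\<in>UNIV. grad_vel M i i p) * number_density M p
         + ((\<Sum>i\<in>UNIV. vel M i p * \<partial>\<^sub>x i (\<D> M) p)
            + ((\<Sum>i\<in>UNIV. \<Sum>k\<in>UNIV. vel M i p * (grad_vel M i k p * \<I> M p $ k))
               + (\<Sum>i\<in>UNIV. \<Sum>k\<in>UNIV. vel M i p * (vel M k p * \<partial>\<^sub>x i (\<lambda>q. \<I> M q $ k) p))))))"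
    unfolding dX_momentum_density
    by (simp only: sum.distrib distrib_left sum_distrib_left sum_distrib_right add.assoc)
  then show ?thesis
    unfolding K dK dI by (simp only: add.assoc)
qed

text \<open>The contribution of the flux equation to the energy law. The terms with \<open>\<partial>\<^sub>i \<K>\<^sup>i\<^sub>j\<close> and \<open>\<partial>\<^sub>i \<I>\<^sub>j\<close>
  are the negatives of terms in \<open>momentum_divergence\<close>; the one with \<open>\<partial>\<^sub>i v\<^sup>i\<close> cancels the part \<open>v\<^sup>j \<I>\<^sub>j\<close> of the
  number density there.\<close>

lemma vel_dT_number_flux:
  "(\<Sum>j\<in>UNIV. vel M j p * \<partial>\<^sub>t (number_flux M j) p) =
     - (kappa M p * (\<Sum>j\<in>UNIV. vel M j p * \<I> M p $ j))
     + (\<Sum>j\<in>UNIV. vel M j p * (4 * Q_grad M j p + energy p * dE_Q_grad j))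
     - (\<Sum>j\<in>UNIV. \<Sum>i\<in>UNIV. vel M j p * (grad_vel M i j p * \<I> M p $ i))
     - (\<Sum>j\<in>UNIV. vel M j p * (\<Sum>i\<in>UNIV. \<partial>\<^sub>x i (\<lambda>q. \<K> M q $ i $ j) p))
     - (\<Sum>i\<in>UNIV. grad_vel M i i p) * (\<Sum>j\<in>UNIV. vel M j p * \<I> M p $ j)
     - (\<Sum>j\<in>UNIV. vel M j p * (\<Sum>i\<in>UNIV. vel M i p * \<partial>\<^sub>x i (\<lambda>q. \<I> M q $ j) p))"
proof -
  have "vel M j p * \<partial>\<^sub>t (number_flux M j) p =
     - (kappa M p * (vel M j p * \<I> M p $ j))
     + vel M j p * (4 * Q_grad M j p + energy p * dE_Q_grad j)
     - (\<Sum>i\<in>UNIV. vel M j p * (grad_vel M i j p * \<I> M p $ i))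
     - vel M j p * (\<Sum>i\<in>UNIV. \<partial>\<^sub>x i (\<lambda>q. \<K> M q $ i $ j) p)
     - (\<Sum>i\<in>UNIV. grad_vel M i i p) * (vel M j p * \<I> M p $ j)
     - vel M j p * (\<Sum>i\<in>UNIV. vel M i p * \<partial>\<^sub>x i (\<lambda>q. \<I> M q $ j) p)" for j
  proof -
    have "(\<Sum>i\<in>UNIV. \<I> M p $ i * grad_vel M i j p) = (\<Sum>i\<in>UNIV. grad_vel M i j p * \<I> M p $ i)"
      by (simp only: mult.commute)
    then show ?thesis
      unfolding dT_number_flux sum.distrib sum_distrib_right[symmetric] sum_distrib_left[symmetric]
      by (simp only:) (simp add: algebra_simps)
  qed
  then show ?thesis
    by (simp only: sum.distrib sum_subtractf sum_negf sum_distrib_left[of "kappa M p"]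
        sum_distrib_left[of "\<Sum>i\<in>UNIV. grad_vel M i i p"])
qed

lemma energy_balance:
  "\<partial>\<^sub>t (energy_density M) p + (\<Sum>i\<in>UNIV. \<partial>\<^sub>x i (momentum_density M i) p)
     - 1 / (energy p)^2 * \<partial>\<^sub>\<epsilon> (\<lambda>q. (energy q)^4 * K_grad M q) p
   = energy p * chi M p * (\<D>\<^sub>0 M p - \<D> M p)
     - energy p * kappa M p * (\<Sum>j\<in>UNIV. vel M j p * \<I> M p $ j)
     + energy_remainder M p"
proof -
  have E: "1 / (energy p)^2 * \<partial>\<^sub>\<epsilon> (\<lambda>q. (energy q)^4 * K_grad M q) p
      = energy p * (4 * K_grad M p + energy p * dE_K_grad)"
    unfolding has_partial_derivD[OF energy_deriv_power_K_grad]
    using energy_positive by (simp add: field_simps power2_eq_square power3_eq_cube power4_eq_xxxx)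
  show ?thesis
    unfolding E dT_energy_density dT_number_density vel_dT_number_flux momentum_divergence
      energy_remainder_def number_density_def sum.distrib sum_distrib_right[symmetric]
    by algebra
qed

lemma momentum_balance:
  "\<partial>\<^sub>t (momentum_density M j) p + (\<Sum>i\<in>UNIV. \<partial>\<^sub>x i (stress M i j) p)
     - 1 / (energy p)^2 * \<partial>\<^sub>\<epsilon> (\<lambda>q. (energy q)^4 * Q_grad M j q) p
   = - (energy p * kappa M p * \<I> M p $ j)
     + energy p * vel M j p * chi M p * (\<D>\<^sub>0 M p - \<D> M p)
     + momentum_remainder j M p"
proof -
  have E: "1 / (energy p)^2 * \<partial>\<^sub>\<epsilon> (\<lambda>q. (energy q)^4 * Q_grad M j q) p
      = energy p * (4 * Q_grad M j p + energy p * dE_Q_grad j)"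
    unfolding has_partial_derivD[OF energy_deriv_power_Q_grad]
    using energy_positive by (simp add: field_simps power2_eq_square power3_eq_cube power4_eq_xxxx)
  show ?thesis
    unfolding E dT_momentum_density dT_number_density dT_number_flux dX_stress
      momentum_remainder_def sum.distrib sum_distrib_right[symmetric] sum_distrib_left[symmetric]
    by algebra
qed

end

section \<open>Conservation up to second order\<close>

theorem proposition1:
  shows
    "(eq_dropping_v2 two_moment_model
       (\<lambda>M p. \<partial>\<^sub>t (energy_density M) p
              + (\<Sum>i\<in>UNIV. \<partial>\<^sub>x i (momentum_density M i) p)
              - 1 / (energy p)^2 * \<partial>\<^sub>\<epsilon> (\<lambda>q. (energy q)^4 *
                  (\<Sum>i\<in>UNIV. \<Sum>k\<in>UNIV. \<K> M q $ i $ k * grad_vel M i k q)) p)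
       (\<lambda>M p. energy p * chi M p * (\<D>\<^sub>0 M p - \<D> M p)
              - energy p * kappa M p * (\<Sum>j\<in>UNIV. vel M j p * \<I> M p $ j)))
     \<and>
     (\<forall>j. eq_dropping_v2 two_moment_model
       (\<lambda>M p. \<partial>\<^sub>t (momentum_density M j) p
              + (\<Sum>i\<in>UNIV. \<partial>\<^sub>x i (stress M i j) p)
              - 1 / (energy p)^2 * \<partial>\<^sub>\<epsilon> (\<lambda>q. (energy q)^4 *
                  (\<Sum>i\<in>UNIV. \<Sum>k\<in>UNIV. \<Q> M q $ i $ k $ j * grad_vel M i k q)) p)
       (\<lambda>M p. - (energy p * kappa M p * \<I> M p $ j)
              + energy p * vel M j p * chi M p * (\<D>\<^sub>0 M p - \<D> M p)))
     \<and>
     (conservation_law_dropping_v2 (\<lambda>M. two_moment_model M \<and> collisionless M)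
       energy_density
       momentum_density
       (\<lambda>M p. - ((energy p)^2 *
          (\<Sum>i\<in>UNIV. \<Sum>k\<in>UNIV. \<K> M p $ i $ k * grad_vel M i k p))))
     \<and>
     (\<forall>j. conservation_law_dropping_v2 (\<lambda>M. two_moment_model M \<and> collisionless M)
       (\<lambda>M. momentum_density M j)
       (\<lambda>M i. stress M i j)
       (\<lambda>M p. - ((energy p)^2 *
          (\<Sum>i\<in>UNIV. \<Sum>k\<in>UNIV. \<Q> M p $ i $ k $ j * grad_vel M i k p))))"
  unfolding conservation_law_dropping_v2_def phase_space_divergence_def
    K_grad_def[symmetric] Q_grad_def[symmetric]
proof (intro conjI allI)
  show "eq_dropping_v2 two_moment_model
      (\<lambda>M p. \<partial>\<^sub>t (energy_density M) p + (\<Sum>i\<in>UNIV. \<partial>\<^sub>x i (momentum_density M i) p)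
         - 1 / (energy p)^2 * \<partial>\<^sub>\<epsilon> (\<lambda>q. (energy q)^4 * K_grad M q) p)
      (\<lambda>M p. energy p * chi M p * (\<D>\<^sub>0 M p - \<D> M p)
         - energy p * kappa M p * (\<Sum>j\<in>UNIV. vel M j p * \<I> M p $ j))"
    by (rule eq_dropping_v2I[OF velocity_order_energy_remainder energy_balance])
  show "eq_dropping_v2 two_moment_model
      (\<lambda>M p. \<partial>\<^sub>t (momentum_density M j) p + (\<Sum>i\<in>UNIV. \<partial>\<^sub>x i (stress M i j) p)
         - 1 / (energy p)^2 * \<partial>\<^sub>\<epsilon> (\<lambda>q. (energy q)^4 * Q_grad M j q) p)
      (\<lambda>M p. - (energy p * kappa M p * \<I> M p $ j)
         + energy p * vel M j p * chi M p * (\<D>\<^sub>0 M p - \<D> M p))" for j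
    by (rule eq_dropping_v2I[OF velocity_order_momentum_remainder momentum_balance])
  show "eq_dropping_v2 (\<lambda>M. two_moment_model M \<and> collisionless M)
      (\<lambda>M p. \<partial>\<^sub>t (energy_density M) p + (\<Sum>i\<in>UNIV. \<partial>\<^sub>x i (momentum_density M i) p)
         + 1 / (energy p)^2 * \<partial>\<^sub>\<epsilon> (\<lambda>q. (energy q)^2 * - ((energy q)^2 * K_grad M q)) p)
      (\<lambda>M p. 0)"
  proof (rule eq_dropping_v2I[OF velocity_order_energy_remainder])
    fix M p assume M: "two_moment_model M \<and> collisionless M" and p: "p \<in> phase_space M"
    then have "chi M p = 0" "kappa M p = 0" by (auto simp: collisionless_def)
    then show "\<partial>\<^sub>t (energy_density M) p + (\<Sum>i\<in>UNIV. \<partial>\<^sub>x i (momentum_density M i) p)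
        + 1 / (energy p)^2 * \<partial>\<^sub>\<epsilon> (\<lambda>q. (energy q)^2 * - ((energy q)^2 * K_grad M q)) p
      = 0 + energy_remainder M p"
      using energy_balance[OF M[THEN conjunct1] p]
      by (simp only: minus_energy_flux_deriv[OF energy_deriv_power_K_grad[OF M[THEN conjunct1] p]])
  qed
  show "eq_dropping_v2 (\<lambda>M. two_moment_model M \<and> collisionless M)
      (\<lambda>M p. \<partial>\<^sub>t (momentum_density M j) p + (\<Sum>i\<in>UNIV. \<partial>\<^sub>x i (stress M i j) p)
         + 1 / (energy p)^2 * \<partial>\<^sub>\<epsilon> (\<lambda>q. (energy q)^2 * - ((energy q)^2 * Q_grad M j q)) p)
      (\<lambda>M p. 0)" for j
  proof (rule eq_dropping_v2I[OF velocity_order_momentum_remainder])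
    fix M p assume M: "two_moment_model M \<and> collisionless M" and p: "p \<in> phase_space M"
    then have "chi M p = 0" "kappa M p = 0" by (auto simp: collisionless_def)
    then show "\<partial>\<^sub>t (momentum_density M j) p + (\<Sum>i\<in>UNIV. \<partial>\<^sub>x i (stress M i j) p)
        + 1 / (energy p)^2 * \<partial>\<^sub>\<epsilon> (\<lambda>q. (energy q)^2 * - ((energy q)^2 * Q_grad M j q)) p
      = 0 + momentum_remainder j M p"
      using momentum_balance[OF M[THEN conjunct1] p, of j]
      by (simp only: minus_energy_flux_deriv[OF energy_deriv_power_Q_grad[OF M[THEN conjunct1] p]])
  qed
qed

end
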